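(* Let $d \geq 1$ be an integer and let $G$ be a connected bipartite graph of order at least $d+1$. Then $V(G)$ can be partitioned into $d+1$ sets, each of which is a $d$-distance independent dominating set of $G$.
   Context: For a graph $G$ with shortest-path distance $d(\cdot,\cdot)$, a set $S\subseteq V(G)$ is a $d$-distance dominating set if every vertex $u\in V(G)\setminus S$ has some $w\in S$ with $d(u,w)\le d$. A $d$-distance independent dominating set is a $d$-distance dominating set that is also an independent set (no two of its vertices are adjacent). *)

theory Defs
  imports "Graph_Theory.Graph_Theory" "HOL-Library.Disjoint_Sets"
begin

text \<open>
  Finite simple graphs are the loop-free symmetric digraphs without parallel arcs of the locale
  \<^locale>\<open>graph\<close>: an undirected edge is a pair of opposite arcs. Connectedness has to be written
  \<open>Digraph_Component.connected\<close>, because the topological notion has the same base name.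
\<close>

definition bipartite :: "('a, 'b) pre_digraph \<Rightarrow> bool" where
  "bipartite G \<longleftrightarrow>
     (\<exists>A B. verts G = A \<union> B \<and> A \<inter> B = {} \<and>
       (\<forall>u v. u \<rightarrow>\<^bsub>G\<^esub> v \<longrightarrow> (u \<in> A \<and> v \<in> B) \<or> (u \<in> B \<and> v \<in> A)))"

text \<open>With unit weights the cost of a walk is its number of arcs; the distance between vertices
  that are not joined by a walk is \<open>\<infinity>\<close>.\<close>

definition graph_dist :: "('a, 'b) pre_digraph \<Rightarrow> 'a \<Rightarrow> 'a \<Rightarrow> ereal" where
  "graph_dist G u v = wf_digraph.\<mu> G (\<lambda>_. 1) u v"

definition distance_dominating :: "('a, 'b) pre_digraph \<Rightarrow> nat \<Rightarrow> 'a set \<Rightarrow> bool" where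
  "distance_dominating G d S \<longleftrightarrow>
     S \<subseteq> verts G \<and> (\<forall>u \<in> verts G - S. \<exists>w \<in> S. graph_dist G u w \<le> ereal (real d))"

definition independent_set :: "('a, 'b) pre_digraph \<Rightarrow> 'a set \<Rightarrow> bool" where
  "independent_set G S \<longleftrightarrow> S \<subseteq> verts G \<and> (\<forall>u \<in> S. \<forall>v \<in> S. \<not> u \<rightarrow>\<^bsub>G\<^esub> v)"

definition distance_independent_dominating ::
    "('a, 'b) pre_digraph \<Rightarrow> nat \<Rightarrow> 'a set \<Rightarrow> bool" where
  "distance_independent_dominating G d S \<longleftrightarrow>
     distance_dominating G d S \<and> independent_set G S"

end

theory Submission
  imports Defs
begin

text \<open>
  If the diameter is less than \<open>d\<close>, any nonempty set dominates, so it suffices to refine the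
  bipartition to \<open>d + 1\<close> classes. Otherwise let \<open>r\<close> and \<open>e\<close> realise the diameter \<open>D \<ge> d\<close> and
  colour each vertex by its distance from \<open>r\<close> modulo \<open>d + 1\<close>. In a bipartite graph adjacent
  vertices lie on consecutive levels, so the colour classes are independent. A vertex \<open>v\<close> on
  level \<open>k\<close> finds levels \<open>k - d, \<dots>, k\<close> on a geodesic to \<open>r\<close>, and if \<open>k < j \<le> d\<close> it finds level
  \<open>j\<close> on a geodesic to \<open>e\<close>: that geodesic has length at most \<open>D\<close> and still needs \<open>D - j\<close> steps
  after reaching level \<open>j\<close>, so it reaches that level within \<open>j\<close> steps.
\<close>

section \<open>Distance levels of a symmetric relation\<close>

text \<open>A natural number rather than an \<open>ereal\<close>, so that levels can be reduced
  modulo \<open>d + 1\<close>. The value is meaningful only when \<open>v\<close> is reachable from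
  \<open>u\<close>.\<close>

definition rel_dist :: "'a rel \<Rightarrow> 'a \<Rightarrow> 'a \<Rightarrow> nat" where
  "rel_dist R u v = (LEAST n. (u, v) \<in> R ^^ n)"

lemma rel_dist_le: "(u, v) \<in> R ^^ n \<Longrightarrow> rel_dist R u v \<le> n"
  unfolding rel_dist_def by (rule Least_le)

lemma relpow_rel_dist:
  assumes "(u, v) \<in> R\<^sup>*"
  shows "(u, v) \<in> R ^^ rel_dist R u v"
proof -
  obtain n where "(u, v) \<in> R ^^ n"
    using assms rtrancl_imp_relpow by blast
  then show ?thesis
    unfolding rel_dist_def by (rule LeastI)
qed

lemma rel_dist_self [simp]: "rel_dist R u u = 0"
  using rel_dist_le[where n = 0] by fastforce

lemma rel_dist_step:
  assumes "(r, u) \<in> R\<^sup>*" "(u, v) \<in> R"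
  shows "rel_dist R r v \<le> Suc (rel_dist R r u)"
  using relpow_rel_dist[OF assms(1)] assms(2) by (intro rel_dist_le) auto

lemma sym_relpow_commute:
  assumes "sym R" "(u, v) \<in> R ^^ n"
  shows "(v, u) \<in> R ^^ n"
  using assms(2)
proof (induction n arbitrary: v)
  case (Suc n)
  then obtain w where "(u, w) \<in> R ^^ n" "(w, v) \<in> R"
    by auto
  then show ?case
    using Suc.IH symD[OF assms(1)] by (metis relpow_Suc_I2)
qed simp

text \<open>Serves as a lower bound on \<open>n\<close>: a walk is at least as long as the rise in
  level between its ends.\<close>

lemma relpow_lipschitz:
  fixes f :: "'a \<Rightarrow> nat"
  assumes "\<And>x y. (x, y) \<in> R \<Longrightarrow> f y \<le> Suc (f x)" "(u, v) \<in> R ^^ n"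
  shows "f v \<le> f u + n"
  using assms(2)
proof (induction n arbitrary: v)
  case (Suc n)
  then obtain w where "(u, w) \<in> R ^^ n" "(w, v) \<in> R"
    by auto
  then show ?case
    using Suc.IH[of w] assms(1)[of w v] by simp
qed simp

text \<open>Discrete intermediate value theorem: \<open>f\<close> climbs by at most one per step, so
  a walk cannot jump over \<open>j\<close>. The lengths of both pieces are recorded because either
  may have to be bounded.\<close>

lemma relpow_intermediate_value:
  fixes f :: "'a \<Rightarrow> nat"
  assumes "\<And>x y. (x, y) \<in> R \<Longrightarrow> f y \<le> Suc (f x)" "(u, v) \<in> R ^^ n" "f u \<le> j" "j \<le> f v"
  shows "\<exists>w m. m \<le> n \<and> f w = j \<and> (u, w) \<in> R ^^ m \<and> (w, v) \<in> R ^^ (n - m)"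
  using assms(2,4)
proof (induction n arbitrary: v)
  case 0
  then show ?case using assms(3) by auto
next
  case (Suc n)
  show ?case
  proof (cases "f v = j")
    case True
    then show ?thesis
      using Suc.prems(1) by (intro exI[of _ v] exI[of _ "Suc n"]) auto
  next
    case False
    obtain x where x: "(u, x) \<in> R ^^ n" "(x, v) \<in> R"
      using Suc.prems(1) by auto
    then have "j \<le> f x"
      using assms(1)[OF x(2)] False Suc.prems(2) by linarith
    then obtain w m where w: "m \<le> n" "f w = j" "(u, w) \<in> R ^^ m" "(w, x) \<in> R ^^ (n - m)"
      using Suc.IH[OF x(1)] by blast
    then have "(w, v) \<in> R ^^ (Suc n - m)"
      using x(2) by (auto simp: Suc_diff_le)
    with w show ?thesis
      by (intro exI[of _ w] exI[of _ m]) auto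
  qed
qed

text \<open>The witness is \<open>j\<close> plus the largest multiple of \<open>n\<close> that keeps
  the sum at most \<open>k\<close>; the next multiple overshoots.\<close>

lemma ex_congruent_below:
  fixes j k n :: nat
  assumes "j \<le> k" "j < n"
  shows "\<exists>i\<le>k. i mod n = j \<and> k < i + n"
proof -
  have "n * ((k - j) div n) + (k - j) mod n = k - j"
    by (rule mult_div_mod_eq)
  moreover have "(k - j) mod n < n"
    using assms by simp
  ultimately have "j + n * ((k - j) div n) \<le> k" "k < j + n * ((k - j) div n) + n"
    using assms(1) by linarith+
  then show ?thesis
    using assms(2) by (intro exI[of _ "j + n * ((k - j) div n)"]) simp
qed

lemma peripheral_levels_dominate:
  assumes "sym R"
    and conn: "\<And>u v. u \<in> V \<Longrightarrow> v \<in> V \<Longrightarrow> (u, v) \<in> R\<^sup>*"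
    and RV: "R \<subseteq> V \<times> V"
    and V: "r \<in> V" "e \<in> V" "v \<in> V"
    and diam: "rel_dist R v e \<le> rel_dist R r e" and "d \<le> rel_dist R r e" "j \<le> d"
  shows "\<exists>w n. w \<in> V \<and> n \<le> d \<and> rel_dist R r w mod (d + 1) = j \<and> (v, w) \<in> R ^^ n"
proof -
  let ?f = "rel_dist R r"
  have step: "?f y \<le> Suc (?f x)" if "(x, y) \<in> R" for x y
    using that RV by (intro rel_dist_step conn V) auto
  have in_V: "w \<in> V" if "(v, w) \<in> R ^^ n" for w n
    using that V(3) RV by (cases n) auto
  show ?thesis
  proof (cases "?f v < j")
    case True
    obtain w m where w: "m \<le> rel_dist R v e" "?f w = j" "(v, w) \<in> R ^^ m"
        "(w, e) \<in> R ^^ (rel_dist R v e - m)"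
      using relpow_intermediate_value[of R ?f, OF step relpow_rel_dist[OF conn[OF V(3,2)]], of j]
        True assms(8,9) by auto
    \<comment> \<open>Let \<open>D = rel_dist R r e\<close>. The piece from \<open>w\<close> to
      \<open>e\<close> climbs from level \<open>j\<close> to level \<open>D\<close>, so it has
      length at least \<open>D - j\<close>. The whole geodesic has length at most \<open>D\<close>,
      hence \<open>m \<le> j\<close>.\<close>
    have "?f e \<le> j + (rel_dist R v e - m)"
      using relpow_lipschitz[of R ?f, OF step w(4)] w(2) by simp
    then have "m \<le> d"
      using w(1) diam \<open>j \<le> d\<close> by linarith
    then show ?thesis
      using w in_V \<open>j \<le> d\<close> by (intro exI[of _ w] exI[of _ m]) auto
  next
    case False
    then obtain i where i: "i \<le> ?f v" "i mod (d + 1) = j" "?f v < i + (d + 1)"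
      using ex_congruent_below[of j "?f v" "d + 1"] \<open>j \<le> d\<close> by auto
    obtain w m where w: "m \<le> ?f v" "?f w = i" "(r, w) \<in> R ^^ m" "(w, v) \<in> R ^^ (?f v - m)"
      using relpow_intermediate_value[of R ?f, OF step relpow_rel_dist[OF conn[OF V(1,3)]], of i]
        i(1) by auto
    \<comment> \<open>Reaching level \<open>i\<close> takes at least \<open>i\<close> steps, so at
      most \<open>?f v - i\<close> steps of the geodesic remain, which is at most
      \<open>d\<close>.\<close>
    have "?f w \<le> m"
      using w(3) by (rule rel_dist_le)
    then have "?f v - m \<le> d"
      using w(2) i(3) by linarith
    moreover have "(v, w) \<in> R ^^ (?f v - m)"
      using sym_relpow_commute[OF \<open>sym R\<close> w(4)] .
    ultimately show ?thesis
      using w(2) i(2) in_V by blast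
  qed
qed

text \<open>Each arc changes sides. Applied to geodesics from a root, this puts all vertices of one
  level on the same side.\<close>

lemma relpow_bipartite_parity:
  assumes "A \<inter> B = {}" "\<And>x y. (x, y) \<in> R \<Longrightarrow> x \<in> A \<and> y \<in> B \<or> x \<in> B \<and> y \<in> A"
    and "(u, v) \<in> R ^^ n" "u \<in> A \<union> B"
  shows "(u \<in> A \<longleftrightarrow> v \<in> A) \<longleftrightarrow> even n"
  using assms(3)
proof (induction n arbitrary: v)
  case (Suc n)
  then obtain w where w: "(u, w) \<in> R ^^ n" "(w, v) \<in> R"
    by auto
  have "w \<in> A \<longleftrightarrow> v \<notin> A"
    using assms(1) assms(2)[OF w(2)] by blast
  then show ?case
    using Suc.IH[OF w(1)] by auto
qed simp

section \<open>Refining a partition to a prescribed number of classes\<close>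

lemma partition_on_split:
  assumes "partition_on V P" "p \<in> P" "x \<in> p" "p \<noteq> {x}" "finite P"
  shows "partition_on V (insert {x} (insert (p - {x}) (P - {p})))"
    and "card (insert {x} (insert (p - {x}) (P - {p}))) = Suc (card P)"
proof -
  have disj: "q \<inter> p = {}" if "q \<in> P - {p}" for q
    using that assms(1,2) by (auto simp: partition_on_def disjoint_def)
  have ne: "q \<noteq> {}" if "q \<in> P" for q
    using that assms(1) by (auto simp: partition_on_def)
  have "\<Union> (insert {x} (insert (p - {x}) (P - {p}))) = V"
    using assms(1-3) by (auto simp: partition_on_def)
  moreover have "disjoint (insert {x} (insert (p - {x}) (P - {p})))"
    using assms(1,3) disj by (fastforce simp: partition_on_def disjoint_def)
  ultimately show "partition_on V (insert {x} (insert (p - {x}) (P - {p})))"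
    using ne assms(3,4) by (auto simp: partition_on_def)
  \<comment> \<open>Both pieces are new: each is nonempty and meets \<open>p\<close>, while the
    other classes are disjoint from \<open>p\<close>.\<close>
  have "{x} \<notin> insert (p - {x}) (P - {p})" "p - {x} \<notin> P - {p}"
    using disj[of "{x}"] disj[of "p - {x}"] assms(3,4) by auto
  then show "card (insert {x} (insert (p - {x}) (P - {p}))) = Suc (card P)"
    using assms(2,5) card_Suc_Diff1[OF assms(5,2)] by simp
qed

text \<open>As long as there are fewer classes than points, some class has two points and a single
  point can be split off it.\<close>

lemma partition_on_refine_card:
  assumes "finite V" "partition_on V P" "card P \<le> n" "n \<le> card V"
  shows "\<exists>Q. partition_on V Q \<and> card Q = n \<and> (\<forall>q\<in>Q. \<exists>p\<in>P. q \<subseteq> p)"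
  using assms(3,4)
proof (induction n rule: dec_induct)
  case base
  then show ?case using assms(2) by blast
next
  case (step n)
  then obtain Q where Q: "partition_on V Q" "card Q = n" "\<forall>q\<in>Q. \<exists>p\<in>P. q \<subseteq> p"
    by auto
  have "finite Q"
    using finite_elements[OF assms(1) Q(1)] .
  \<comment> \<open>If all \<open>n\<close> classes were singletons, \<open>V\<close> would have at
    most \<open>n\<close> points, but it has at least \<open>Suc n\<close>.\<close>
  have "\<exists>q\<in>Q. \<not> is_singleton q"
  proof (rule ccontr)
    assume singletons: "\<not> ?thesis"
    have "V = \<Union> Q"
      using Q(1) by (simp add: partition_on_def)
    moreover have "card (\<Union> Q) \<le> (\<Sum>q\<in>Q. card q)"
      by (rule card_Union_le_sum_card)
    moreover have "(\<Sum>q\<in>Q. card q) = (\<Sum>q\<in>Q. 1)"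
      using singletons by (intro sum.cong) (auto simp: is_singleton_altdef)
    ultimately show False
      using Q(2) step.prems by simp
  qed
  then obtain q where q: "q \<in> Q" "\<not> is_singleton q"
    by blast
  moreover have "q \<noteq> {}"
    using q Q(1) by (auto simp: partition_on_def)
  ultimately obtain x where x: "x \<in> q" "q \<noteq> {x}"
    by (auto simp: is_singleton_def)
  obtain p where "p \<in> P" "q \<subseteq> p"
    using Q(3) q(1) by blast
  then have "{x} \<subseteq> p" "q - {x} \<subseteq> p"
    using x(1) by auto
  then have "\<forall>q'\<in>insert {x} (insert (q - {x}) (Q - {q})). \<exists>p\<in>P. q' \<subseteq> p"
    using Q(3) \<open>p \<in> P\<close> by auto
  then show ?case
    using partition_on_split[OF Q(1) q(1) x \<open>finite Q\<close>] Q(2) by blast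
qed

section \<open>Distance dominating partitions of bipartite graphs\<close>

context wf_digraph
begin

lemma relpow_imp_awalk:
  assumes "(u, v) \<in> (arcs_ends G) ^^ n" "v \<in> verts G"
  shows "\<exists>p. awalk u p v \<and> length p = n"
  using assms(1)
proof (induction n arbitrary: u)
  case 0
  then show ?case using assms(2) by (auto simp: awalk_Nil_iff)
next
  case (Suc n)
  then obtain w where w: "(u, w) \<in> arcs_ends G" "(w, v) \<in> (arcs_ends G) ^^ n"
    by (meson relpow_Suc_D2)
  then obtain p where p: "awalk w p v" "length p = n"
    using Suc.IH by blast
  obtain a where "a \<in> arcs G" "tail G a = u" "head G a = w"
    using w(1) by (auto simp: arcs_ends_conv)
  with p show ?case
    by (intro exI[of _ "a # p"]) (auto simp: awalk_Cons_iff)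
qed

lemma graph_dist_le_relpow:
  assumes "(u, v) \<in> (arcs_ends G) ^^ n" "v \<in> verts G"
  shows "graph_dist G u v \<le> ereal (real n)"
proof -
  obtain p where p: "awalk u p v" "length p = n"
    using relpow_imp_awalk[OF assms] by blast
  have "awalk_cost (\<lambda>_. 1) p = real n"
    using p(2) by (simp add: awalk_cost_def sum_list_triv)
  then show ?thesis
    using min_cost_le_walk_cost[OF p(1), of "\<lambda>_. 1"] by (simp add: graph_dist_def)
qed

text \<open>Reduces domination to relation powers: any walk bounds \<open>graph_dist\<close> from
  above, so geodesics in the sense of \<open>rel_dist\<close> suffice.\<close>

lemma distance_dominatingI:
  assumes "S \<subseteq> verts G"
    and "\<And>u. u \<in> verts G \<Longrightarrow> \<exists>w\<in>S. \<exists>n\<le>d. (u, w) \<in> (arcs_ends G) ^^ n"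
  shows "distance_dominating G d S"
  unfolding distance_dominating_def
proof (intro conjI ballI)
  fix u assume "u \<in> verts G - S"
  then obtain w n where w: "w \<in> S" "n \<le> d" "(u, w) \<in> (arcs_ends G) ^^ n"
    using assms(2) by blast
  have "graph_dist G u w \<le> ereal (real n)"
    using w assms(1) by (intro graph_dist_le_relpow) auto
  also have "\<dots> \<le> ereal (real d)"
    using w(2) by simp
  finally show "\<exists>w\<in>S. graph_dist G u w \<le> ereal (real d)"
    using w(1) by blast
qed (fact assms(1))

end

theorem theorem2p1:
  fixes G :: "('a, 'b) pre_digraph" and d :: nat
  assumes "d \<ge> 1"
    and "graph G"
    and "Digraph_Component.connected G"
    and "bipartite G"
    and "card (verts G) \<ge> d + 1"
  shows "\<exists>P. partition_on (verts G) P \<and> card P = d + 1 \<and>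
           (\<forall>S \<in> P. distance_independent_dominating G d S)"
proof -
  interpret graph G by fact
  let ?V = "verts G" and ?R = "arcs_ends G"
  let ?dist = "rel_dist ?R"
  have sym: "sym ?R"
    using sym_arcs by (simp add: symmetric_def)
  have RV: "?R \<subseteq> ?V \<times> ?V"
    by (auto simp: arcs_ends_conv)
  \<comment> \<open>Symmetry of the arcs turns weak connectedness into reachability along directed
    arcs.\<close>
  have "strongly_connected G"
    using symmetric_connected_imp_strongly_connected[OF sym_arcs assms(3)] .
  then have conn: "(u, v) \<in> ?R\<^sup>*" if "u \<in> ?V" "v \<in> ?V" for u v
    using that by (auto intro: reachable_rtranclI)
  obtain A B where AB: "?V = A \<union> B" "A \<inter> B = {}"
      "\<And>u v. (u, v) \<in> ?R \<Longrightarrow> u \<in> A \<and> v \<in> B \<or> u \<in> B \<and> v \<in> A"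
    using assms(4) unfolding bipartite_def by blast
  have Vne: "?V \<noteq> {}"
    using assms(5) by auto
  let ?D = "(\<lambda>(u, v). ?dist u v) ` (?V \<times> ?V)"
  have finD: "finite ?D" "?D \<noteq> {}"
    using Vne by auto
  obtain r e where re: "r \<in> ?V" "e \<in> ?V" "?dist r e = Max ?D"
    using Max_in[OF finD] by auto
  have diam: "?dist u v \<le> ?dist r e" if "u \<in> ?V" "v \<in> ?V" for u v
    unfolding re(3) using that finD by (intro Max_ge) auto
  show ?thesis
  proof (cases "d \<le> ?dist r e")
    case True
    define S where "S j = {v \<in> ?V. ?dist r v mod (d + 1) = j}" for j
    have dom: "\<exists>w\<in>S j. \<exists>n\<le>d. (u, w) \<in> ?R ^^ n" if "u \<in> ?V" "j \<le> d" for u j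
      using peripheral_levels_dominate[OF sym conn RV re(1,2) that(1) diam[OF that(1) re(2)] True that(2)]
      unfolding S_def by blast
    \<comment> \<open>Each class contains a vertex that dominates \<open>r\<close>. Nonemptiness
      makes the classes distinct, so that there are exactly \<open>d + 1\<close> of them.\<close>
    have ne: "S j \<noteq> {}" if "j \<le> d" for j
      using dom[OF re(1) that] by blast
    have "inj_on S {..d}"
    proof (rule inj_onI)
      fix i j assume ij: "i \<in> {..d}" "j \<in> {..d}" "S i = S j"
      then obtain x where "x \<in> S i" "x \<in> S j"
        using ne[of i] by auto
      then show "i = j" by (simp add: S_def)
    qed
    then have "card (S ` {..d}) = d + 1"
      by (simp add: card_image)
    moreover have "partition_on ?V (S ` {..d})"
      unfolding partition_on_def disjoint_def
    proof (intro conjI)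
      have "?dist r v mod (d + 1) \<le> d" for v
        using mod_less_divisor[of "d + 1" "?dist r v"] by linarith
      then show "\<Union> (S ` {..d}) = ?V"
        by (auto simp: S_def)
    qed (use ne in \<open>auto simp: S_def\<close>)
    moreover have "independent_set G (S j)" for j
      unfolding independent_set_def
    proof (intro conjI ballI notI)
      fix u v assume uv: "u \<in> S j" "v \<in> S j" and edge: "(u, v) \<in> ?R"
      then have V: "u \<in> ?V" "v \<in> ?V"
        by (auto simp: S_def)
      have "?dist r v \<le> Suc (?dist r u)" "?dist r u \<le> Suc (?dist r v)"
        using edge symD[OF sym edge] V re(1) by (auto intro: rel_dist_step conn)
      moreover have "?dist r u mod (d + 1) = ?dist r v mod (d + 1)"
        using uv by (simp add: S_def)
      \<comment> \<open>The modulus is at least 2, so adjacent vertices of one class cannot lie on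
        consecutive levels and must share a level.\<close>
      moreover have "Suc n mod (d + 1) \<noteq> n mod (d + 1)" for n
        using assms(1) by (simp add: mod_Suc)
      ultimately have "?dist r u = ?dist r v"
        by (metis le_SucE le_antisym)
      \<comment> \<open>Parity then puts \<open>u\<close> and \<open>v\<close> on the same side,
        although an arc joins them.\<close>
      moreover have "(r \<in> A \<longleftrightarrow> x \<in> A) \<longleftrightarrow> even (?dist r x)" if "x \<in> ?V" for x
        using relpow_bipartite_parity[OF AB(2,3) relpow_rel_dist[OF conn[OF re(1) that]]] re(1) AB(1)
        by blast
      ultimately have "u \<in> A \<longleftrightarrow> v \<in> A"
        using V by metis
      then show False
        using AB(2) AB(3)[OF edge] by blast
    qed (auto simp: S_def)
    moreover have "distance_dominating G d (S j)" if "j \<le> d" for j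
      using dom that by (intro distance_dominatingI) (auto simp: S_def)
    ultimately show ?thesis
      by (intro exI[of _ "S ` {..d}"]) (auto simp: distance_independent_dominating_def)
  next
    case False
    \<comment> \<open>Two distinct vertices force an arc, so both sides are nonempty, as the classes
      of a partition must be.\<close>
    have "\<exists>u\<in>?V. \<exists>v\<in>?V. u \<noteq> v"
    proof (rule ccontr)
      assume "\<not> ?thesis"
      then have "card ?V \<le> 1"
        by (auto simp: card_le_Suc0_iff_eq)
      then show False
        using assms(1,5) by simp
    qed
    then obtain u v where "u \<in> ?V" "v \<in> ?V" "u \<noteq> v" by blast
    then obtain w where "(u, w) \<in> ?R"
      using conn by (meson converse_rtranclE)
    then have "A \<noteq> {}" "B \<noteq> {}"
      using AB(3) by blast+
    then have part: "partition_on ?V {A, B}"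
      using AB(1,2) by (auto simp: partition_on_def disjoint_def)
    have "card {A, B} \<le> d + 1"
      using card_insert_le_m1[of 2 "{B}" A] assms(1) by simp
    then obtain Q where Q: "partition_on ?V Q" "card Q = d + 1" "\<forall>q\<in>Q. \<exists>p\<in>{A, B}. q \<subseteq> p"
      using partition_on_refine_card[OF finite_verts part _ assms(5)] by blast
    have "distance_independent_dominating G d q" if "q \<in> Q" for q
    proof -
      have qV: "q \<subseteq> ?V" "q \<noteq> {}"
        using Q(1) that by (auto simp: partition_on_def)
      have "distance_dominating G d q"
      proof (rule distance_dominatingI[OF qV(1)])
        fix u assume "u \<in> ?V"
        obtain w where "w \<in> q" using qV(2) by blast
        \<comment> \<open>All distances are below \<open>d\<close> here, so any element of
          \<open>q\<close> dominates every vertex.\<close>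
        moreover have "(u, w) \<in> ?R ^^ ?dist u w" "?dist u w \<le> d"
          using \<open>u \<in> ?V\<close> \<open>w \<in> q\<close> qV(1) False diam[of u w]
          by (auto intro!: relpow_rel_dist conn)
        ultimately show "\<exists>w\<in>q. \<exists>n\<le>d. (u, w) \<in> ?R ^^ n"
          by blast
      qed
      moreover have "independent_set G q"
        unfolding independent_set_def
      proof (intro conjI ballI notI)
        fix u v assume "u \<in> q" "v \<in> q" and edge: "(u, v) \<in> ?R"
        moreover have "q \<subseteq> A \<or> q \<subseteq> B"
          using Q(3) that by auto
        ultimately show False
          using AB(2) AB(3)[OF edge] by blast
      qed (fact qV(1))
      ultimately show ?thesis
        by (simp add: distance_independent_dominating_def)
    qed
    then show ?thesis
      using Q(1,2) by blast
  qed
qed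

end
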